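(* Consider the problem $\min_{\mathbf U\in\Sigma}E(\mathbf U)$ with $0<\varepsilon<\tilde\varepsilon=1/[K(\rho^{\max}+d_\omega^{\max})]$, where $\rho^{\max}=\max_i\sum_{j=1}^n|(\mathbf L_s)_{ij}|$ and $d_\omega^{\max}=\max_i(\mathbf D_\omega)_{ii}$. Let $L>0$ be a Lipschitz constant of $\nabla E$ (in the Frobenius norm). Let $\{\mathbf U_k\}$ be a sequence generated by the Greedy Frank-Wolfe (GFW) algorithm, with directions $\mathbf D_k$, where the step sizes $\alpha_k$ satisfy $$\alpha_k\ge\bar\alpha_k=\min\Big(1,\frac{g_k}{L\|\mathbf D_k\|_F^2}\Big)$$ as well as $$E(\mathbf U_k)-E(\mathbf U_k+\alpha_k\mathbf D_k)\ge\rho\,\bar\alpha_k\,g_k\quad\text{for some fixed }\rho>0,$$ with $g_k=-\langle\nabla E(\mathbf U_k),\mathbf D_k\rangle$. Then for every $T\in\mathbb N$, $T\geq 1$, $$g_T^*\le\max\left(\sqrt{\frac{2nL\,(E(\mathbf U_0)-E^* )}{\rho T}},\ \frac{2(E(\mathbf U_0)-E^* )}{T}\right),$$ where $g_k^*=\min_{0\le i\le k-1}g_i$ and $E^*=\min_{\mathbf U\in\Sigma}E(\mathbf U)$.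
   Context: Setting. $G=(V,E)$ is an undirected connected graph with $n$ vertices and symmetric weighted adjacency matrix $\mathbf W=(w_{ij})\in\mathbb R^{n\times n}$, $w_{ij}\ge 0$. $\mathbf D$ is the diagonal degree matrix with entries $d_i=\sum_j w_{ij}$, assumed invertible, and $\mathbf L_s=\mathbf I-\mathbf D^{-1/2}\mathbf W\mathbf D^{-1/2}$ is the symmetric normalized graph Laplacian. $K>2$ is the number of classes. A nonempty subset of nodes (the fidelity nodes) has known labels: $\omega_i=\omega_0>0$ if $i$ is a fidelity node and $\omega_i=0$ otherwise, and $\mathbf D_\omega=\mathrm{diag}(\omega_1,\dots,\omega_n)$. The matrix $\hat{\mathbf U}=(\hat{\mathbf u}_1,\dots,\hat{\mathbf u}_n)^\top\in\mathbb R^{n\times K}$ has row $\hat{\mathbf u}_i$ equal to the known label (a canonical basis vector of $\mathbb R^K$) when $i$ is a fidelity node; the other rows do not affect the energy. For $\mathbf U=(\mathbf u_1,\dots,\mathbf u_n)^\top\in\mathbb R^{n\times K}$ and $\varepsilon>0$, $$E(\mathbf U)=\tfrac12\,\mathrm{trace}(\mathbf U^\top\mathbf L_s\mathbf U)+\frac1\varepsilon\sum_{i=1}^n\mathbf u_i^\top(\mathbf 1-\mathbf u_i)+\tfrac12\|\mathbf D_\omega^{1/2}(\hat{\mathbf U}-\mathbf U)\|_F^2,$$ with $\mathbf 1$ all-ones, and $\nabla E(\mathbf U)=\mathbf L_s\mathbf U+\frac1\varepsilon(\mathbf 1-2\mathbf U)-\mathbf D_\omega(\hat{\mathbf U}-\mathbf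 U)$. The feasible set is $\Sigma=\{\mathbf U\in\mathbb R^{n\times K}:\mathbf u_i\in\mathbb R^K_{\ge0},\ \mathbf 1^\top\mathbf u_i=1,\ i=1,\dots,n\}$. $\langle\mathbf A,\mathbf B\rangle=\mathrm{trace}(\mathbf A^\top\mathbf B)$ and $\|\cdot\|_F$ is the Frobenius norm. Greedy linear minimization oracle (GLMO). Given $\mathbf U\in\Sigma$ and $\mathbf G=(\mathbf g_1,\dots,\mathbf g_n)^\top=\nabla E(\mathbf U)$, it returns $(\mathbf w_1,\dots,\mathbf w_n)^\top$ where $\mathbf w_i=\mathbf u_i$ if $\mathbf u_i\in\{0,1\}^K$, and otherwise $\mathbf w_i=\mathbf e_{j_i}$ (canonical basis vector of $\mathbb R^K$) with $j_i\in\operatorname{argmin}_{j\in\mathrm{supp}(\mathbf u_i)}(\mathbf g_i)_j$; here $\mathrm{supp}(\mathbf u_i)$ is the set of indices of nonzero entries of $\mathbf u_i$, and ties are broken arbitrarily. GFW algorithm. Choose $\mathbf U_0\in\Sigma$. For $k=0,1,\dots$: let $\mathbf S_k$ be the output of the GLMO at $\mathbf U_k$; set $\mathbf D_k=\mathbf S_k-\mathbf U_k$; set $\mathbf U_{k+1}=\mathbf U_k+\alpha_k\mathbf D_k$ with a step size $\alpha_k\in(0,1]$. (The algorithm is considered run without early stopping.) Convention: if $\mathbf D_k=0$ (so $g_k=0$), the quotient $g_k/(L\|\mathbf D_k\|_F^2)$ is read as $0$. *)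

theory Defs
  imports "HOL-Analysis.Analysis"
begin

text \<open>The vertex set is \<open>UNIV :: 'n set\<close> and the classes are indexed by \<open>'k\<close>, so
  \<open>n = CARD('n)\<close>, \<open>K = CARD('k)\<close>, and an \<open>n \<times> K\<close> matrix has type \<open>real ^ 'k ^ 'n\<close>, with
  \<open>U $ i\<close> its i-th row. On this type \<open>norm\<close> and \<open>\<bullet>\<close> are the Frobenius norm and inner product:\<close>

lemma inner_eq_trace:
  fixes A B :: "real ^ 'k ^ 'n"
  shows "A \<bullet> B = trace (transpose A ** B)"
proof -
  have "trace (transpose A ** B) = (\<Sum>j\<in>UNIV. \<Sum>i\<in>UNIV. A $ i $ j * B $ i $ j)"
    by (simp add: trace_def matrix_matrix_mult_def transpose_def)
  also have "\<dots> = (\<Sum>i\<in>UNIV. \<Sum>j\<in>UNIV. A $ i $ j * B $ i $ j)"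
    by (rule sum.swap)
  finally show ?thesis
    by (simp add: inner_vec_def)
qed

definition diag_mat :: "real ^ 'n \<Rightarrow> real ^ 'n ^ 'n" where
  "diag_mat v = (\<chi> i j. if i = j then v $ i else 0)"


text \<open>A weighted graph is given by its adjacency matrix; its edges are the pairs of positive weight.\<close>

definition connected_weights :: "real ^ 'n ^ 'n \<Rightarrow> bool" where
  "connected_weights W \<longleftrightarrow> (\<forall>i j. (i, j) \<in> {(a, b). W $ a $ b > 0}\<^sup>*)"

definition degrees :: "real ^ 'n ^ 'n \<Rightarrow> real ^ 'n" where
  "degrees W = (\<chi> i. \<Sum>j\<in>UNIV. W $ i $ j)"

definition sym_laplacian :: "real ^ 'n ^ 'n \<Rightarrow> real ^ 'n ^ 'n" where
  "sym_laplacian W =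
     mat 1 - diag_mat (\<chi> i. 1 / sqrt (degrees W $ i)) ** W
               ** diag_mat (\<chi> i. 1 / sqrt (degrees W $ i))"


definition fidelity_weights :: "'n set \<Rightarrow> real \<Rightarrow> real ^ 'n" where
  "fidelity_weights F \<omega>0 = (\<chi> i. if i \<in> F then \<omega>0 else 0)"

text \<open>Below, \<open>1 :: real ^ 'k\<close> and \<open>1 :: real ^ 'k ^ 'n\<close> are the all-ones vector and the all-ones matrix
  (not the identity matrix, which is \<open>mat 1\<close>).\<close>

definition energy ::
  "real ^ 'n ^ 'n \<Rightarrow> real ^ 'n \<Rightarrow> real ^ 'k ^ 'n \<Rightarrow> real \<Rightarrow> real ^ 'k ^ 'n \<Rightarrow> real" where
  "energy W \<omega> Uhat \<epsilon> U =
     1 / 2 * trace (transpose U ** sym_laplacian W ** U)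
     + 1 / \<epsilon> * (\<Sum>i\<in>UNIV. U $ i \<bullet> (1 - U $ i))
     + 1 / 2 * (norm (diag_mat (\<chi> i. sqrt (\<omega> $ i)) ** (Uhat - U)))\<^sup>2"

definition grad_energy ::
  "real ^ 'n ^ 'n \<Rightarrow> real ^ 'n \<Rightarrow> real ^ 'k ^ 'n \<Rightarrow> real \<Rightarrow> real ^ 'k ^ 'n \<Rightarrow> real ^ 'k ^ 'n" where
  "grad_energy W \<omega> Uhat \<epsilon> U =
     sym_laplacian W ** U + (1 / \<epsilon>) *\<^sub>R (1 - 2 *\<^sub>R U) - diag_mat \<omega> ** (Uhat - U)"

definition feasible :: "(real ^ 'k ^ 'n) set" where
  "feasible = {U. \<forall>i. (\<forall>j. 0 \<le> U $ i $ j) \<and> (\<Sum>j\<in>UNIV. U $ i $ j) = 1}"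

text \<open>The infimum over the feasible set is attained, see \<open>min_energy_attained\<close>.\<close>

definition min_energy :: "real ^ 'n ^ 'n \<Rightarrow> real ^ 'n \<Rightarrow> real ^ 'k ^ 'n \<Rightarrow> real \<Rightarrow> real" where
  "min_energy W \<omega> Uhat \<epsilon> = (INF U\<in>feasible. energy W \<omega> Uhat \<epsilon> U)"

text \<open>\<open>glmo_output G U S\<close>: \<open>S\<close> is a possible output of the oracle at \<open>U\<close> with gradient \<open>G\<close>. It is a
  relation because ties in the argmin are broken arbitrarily.\<close>

definition glmo_output :: "real ^ 'k ^ 'n \<Rightarrow> real ^ 'k ^ 'n \<Rightarrow> real ^ 'k ^ 'n \<Rightarrow> bool" where
  "glmo_output G U S \<longleftrightarrow>
     (\<forall>i. if \<forall>j. U $ i $ j \<in> {0, 1} then S $ i = U $ i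
          else \<exists>j. is_arg_min (\<lambda>j. G $ i $ j) (\<lambda>j. U $ i $ j \<noteq> 0) j \<and> S $ i = axis j 1)"

definition gfw_sequence ::
  "(real ^ 'k ^ 'n \<Rightarrow> real ^ 'k ^ 'n) \<Rightarrow> (nat \<Rightarrow> real ^ 'k ^ 'n) \<Rightarrow> (nat \<Rightarrow> real ^ 'k ^ 'n)
    \<Rightarrow> (nat \<Rightarrow> real) \<Rightarrow> bool" where
  "gfw_sequence grad U D \<alpha> \<longleftrightarrow>
     U 0 \<in> feasible \<and>
     (\<forall>k. (\<exists>S. glmo_output (grad (U k)) (U k) S \<and> D k = S - U k) \<and>
          0 < \<alpha> k \<and> \<alpha> k \<le> 1 \<and>
          U (Suc k) = U k + \<alpha> k *\<^sub>R D k)"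


lemma linear_matrix_mult_right:
  fixes M :: "real ^ 'm ^ 'n"
  shows "bounded_linear (\<lambda>X :: real ^ 'k ^ 'm. M ** X)"
proof -
  have "linear (\<lambda>X :: real ^ 'k ^ 'm. M ** X)"
    by (rule linearI)
      (simp_all add: vec_eq_iff matrix_matrix_mult_def algebra_simps sum.distrib sum_distrib_left)
  then show ?thesis
    by (simp add: linear_conv_bounded_linear)
qed

lemma inner_matrix_mult:
  fixes A B :: "real ^ 'k ^ 'n" and M :: "real ^ 'n ^ 'n"
  shows "A \<bullet> (M ** B) = (transpose M ** A) \<bullet> B"
  by (simp add: inner_eq_trace matrix_transpose_mul matrix_mul_assoc)

lemma transpose_diag_mat [simp]: "transpose (diag_mat v) = diag_mat v"
  by (simp add: diag_mat_def transpose_def vec_eq_iff)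

lemma diag_mat_mult_diag_mat: "diag_mat v ** diag_mat w = diag_mat (\<chi> i. v $ i * w $ i)"
proof -
  have "(\<Sum>k\<in>UNIV. (if i = k then v $ i else 0) * (if k = j then w $ k else 0))
      = (\<Sum>k\<in>UNIV. if k = i then (if i = j then v $ i * w $ i else 0) else 0)" for i j
    by (rule sum.cong) auto
  then show ?thesis
    by (simp add: diag_mat_def matrix_matrix_mult_def vec_eq_iff)
qed

lemma transpose_sym_laplacian:
  fixes W :: "real ^ 'n ^ 'n"
  assumes "transpose W = W"
  shows "transpose (sym_laplacian W) = sym_laplacian W"
proof -
  have "transpose (A - B) = transpose A - transpose B" for A B :: "real ^ 'n ^ 'n"
    by (simp add: transpose_def vec_eq_iff)
  then show ?thesis
    by (simp add: sym_laplacian_def matrix_transpose_mul assms matrix_mul_assoc[symmetric])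
qed

lemma energy_alt:
  "energy W \<omega> Uhat \<epsilon> U =
     1 / 2 * (U \<bullet> (sym_laplacian W ** U)) + 1 / \<epsilon> * (U \<bullet> (1 - U))
     + 1 / 2 * ((diag_mat (\<chi> i. sqrt (\<omega> $ i)) ** (Uhat - U)) \<bullet>
                (diag_mat (\<chi> i. sqrt (\<omega> $ i)) ** (Uhat - U)))"
  by (simp add: energy_def inner_eq_trace[of U "sym_laplacian W ** U"] matrix_mul_assoc
      inner_vec_def[of U "1 - U"] power2_norm_eq_inner)

lemma grad_energy_correct:
  fixes W :: "real ^ 'n ^ 'n" and Uhat U :: "real ^ 'k ^ 'n"
  assumes sym: "transpose W = W" and pos: "\<And>i. 0 \<le> \<omega> $ i"
  shows "GDERIV (energy W \<omega> Uhat \<epsilon>) U :> grad_energy W \<omega> Uhat \<epsilon> U"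
proof -
  define R where "R = diag_mat (\<chi> i. sqrt (\<omega> $ i))"
  let ?L = "sym_laplacian W"
  have LS: "U \<bullet> (?L ** H) = (?L ** U) \<bullet> H" for H
    by (simp add: inner_matrix_mult transpose_sym_laplacian sym)
  have RR: "(R ** X) \<bullet> (R ** H) = (diag_mat \<omega> ** X) \<bullet> H" for X H :: "real ^ 'k ^ 'n"
  proof -
    have "R ** R = diag_mat \<omega>"
      using pos by (simp add: R_def diag_mat_mult_diag_mat)
    moreover have "transpose R = R"
      by (simp add: R_def)
    ultimately show ?thesis
      by (simp add: inner_matrix_mult matrix_mul_assoc)
  qed
  have neg: "R ** (- H) = - (R ** H)" for H :: "real ^ 'k ^ 'n"
    by (simp add: vec_eq_iff matrix_matrix_mult_def sum_negf)
  have "((\<lambda>U. 1 / 2 * (U \<bullet> (?L ** U)) + 1 / \<epsilon> * (U \<bullet> (1 - U))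
           + 1 / 2 * ((R ** (Uhat - U)) \<bullet> (R ** (Uhat - U))))
         has_derivative
          (\<lambda>H. 1 / 2 * (U \<bullet> (?L ** H) + H \<bullet> (?L ** U)) + 1 / \<epsilon> * (U \<bullet> (0 - H) + H \<bullet> (1 - U))
             + 1 / 2 * ((R ** (Uhat - U)) \<bullet> (R ** (0 - H)) + (R ** (0 - H)) \<bullet> (R ** (Uhat - U)))))
         (at U)"
    by (intro has_derivative_add has_derivative_mult_right has_derivative_inner has_derivative_diff
        has_derivative_ident has_derivative_const
        bounded_linear.has_derivative[OF linear_matrix_mult_right])
  moreover have "1 / 2 * (U \<bullet> (?L ** H) + H \<bullet> (?L ** U)) + 1 / \<epsilon> * (U \<bullet> (0 - H) + H \<bullet> (1 - U))
             + 1 / 2 * ((R ** (Uhat - U)) \<bullet> (R ** (0 - H)) + (R ** (0 - H)) \<bullet> (R ** (Uhat - U)))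
           = grad_energy W \<omega> Uhat \<epsilon> U \<bullet> H" for H
  proof -
    have "U \<bullet> (?L ** H) + H \<bullet> (?L ** U) = 2 * ((?L ** U) \<bullet> H)"
      by (simp add: LS inner_commute[of H])
    moreover have "U \<bullet> (0 - H) + H \<bullet> (1 - U) = (1 - 2 *\<^sub>R U) \<bullet> H"
      by (simp add: inner_diff_left inner_diff_right inner_commute[of H])
    moreover have "(R ** (Uhat - U)) \<bullet> (R ** (0 - H)) + (R ** (0 - H)) \<bullet> (R ** (Uhat - U))
        = - 2 * ((diag_mat \<omega> ** (Uhat - U)) \<bullet> H)"
      by (simp only: inner_commute[of "R ** (0 - H)"]) (simp add: neg RR)
    ultimately show ?thesis
      by (simp add: grad_energy_def inner_add_left inner_diff_left)
  qed
  ultimately have "((\<lambda>U. 1 / 2 * (U \<bullet> (?L ** U)) + 1 / \<epsilon> * (U \<bullet> (1 - U))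
           + 1 / 2 * ((R ** (Uhat - U)) \<bullet> (R ** (Uhat - U))))
         has_derivative (\<lambda>H. grad_energy W \<omega> Uhat \<epsilon> U \<bullet> H)) (at U)"
    by simp
  then show ?thesis
    by (simp add: gderiv_def energy_alt[abs_def] R_def inner_commute[of _ "grad_energy W \<omega> Uhat \<epsilon> U"])
qed

lemma compact_feasible: "compact (feasible :: (real ^ 'k ^ 'n) set)"
proof -
  have "closed (feasible :: (real ^ 'k ^ 'n) set)"
    unfolding feasible_def
    by (intro closed_Collect_all closed_Collect_conj closed_Collect_le closed_Collect_eq
        continuous_intros)
  moreover have "bounded (feasible :: (real ^ 'k ^ 'n) set)"
  proof (rule boundedI)
    fix U :: "real ^ 'k ^ 'n" assume U: "U \<in> feasible"
    have "norm U \<le> (\<Sum>i\<in>UNIV. norm (U $ i))"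
      by (simp add: norm_vec_def L2_set_le_sum)
    also have "\<dots> \<le> (\<Sum>i\<in>(UNIV :: 'n set). 1)"
    proof (rule sum_mono)
      fix i
      have "norm (U $ i) \<le> (\<Sum>j\<in>UNIV. \<bar>U $ i $ j\<bar>)"
        by (rule norm_le_l1_cart)
      also have "\<dots> = 1"
        using U by (simp add: feasible_def)
      finally show "norm (U $ i) \<le> 1" .
    qed
    finally show "norm U \<le> CARD('n)" by simp
  qed
  ultimately show ?thesis
    by (simp add: compact_eq_bounded_closed)
qed

lemma feasible_nonempty: "(feasible :: (real ^ 'k ^ 'n) set) \<noteq> {}"
proof -
  have "(\<chi> i j. 1 / real CARD('k)) \<in> (feasible :: (real ^ 'k ^ 'n) set)"
    by (simp add: feasible_def)
  then show ?thesis by blast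
qed

lemma min_energy_attained:
  fixes Uhat :: "real ^ 'k ^ 'n"
  shows "\<exists>U\<in>feasible. energy W \<omega> Uhat \<epsilon> U = min_energy W \<omega> Uhat \<epsilon> \<and>
           (\<forall>V\<in>feasible. energy W \<omega> Uhat \<epsilon> U \<le> energy W \<omega> Uhat \<epsilon> V)"
proof -
  have "continuous_on feasible (energy W \<omega> Uhat \<epsilon>)"
    unfolding energy_alt[abs_def]
    by (intro continuous_intros bounded_linear.continuous_on[OF linear_matrix_mult_right])
  then obtain U where U: "U \<in> feasible"
    and min: "\<And>V. V \<in> feasible \<Longrightarrow> energy W \<omega> Uhat \<epsilon> U \<le> energy W \<omega> Uhat \<epsilon> V"
    using continuous_attains_inf[OF compact_feasible feasible_nonempty] by metis
  have "min_energy W \<omega> Uhat \<epsilon> = energy W \<omega> Uhat \<epsilon> U"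
    unfolding min_energy_def using U min by (intro cInf_eq_minimum) auto
  then show ?thesis
    using U min by auto
qed

end

theory Submission
  imports Defs
begin

text \<open>The bound is a telescoping argument: along the iterates \<open>E\<close> can drop by at most
  \<open>E (U 0) - Estar\<close> in total, and each of the first \<open>T\<close> steps uses up an amount that is controlled from below by its gap \<open>g k\<close>. Two
  regimes occur.

  If the short step \<open>g k / (L * (norm (D k))\<^sup>2)\<close> is below \<open>1\<close>, the sufficient decrease condition is worth
  \<open>\<rho> * (g k)\<^sup>2 / (L * (norm (D k))\<^sup>2)\<close>, and \<open>(norm (D k))\<^sup>2 \<le> 2 * n\<close> because \<open>D k\<close> is a difference of two
  feasible points (\<open>norm_diff_feasible\<close>). If it is at least \<open>1\<close>, the condition would only give
  \<open>\<rho> * g k\<close>. But in that case the step size is forced to be \<open>1\<close>, so the descent lemma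
  (\<open>descent_lemma\<close>) applies to the full step and gives \<open>g k / 2\<close>, without \<open>\<rho>\<close>. Hence every step with
  positive gap decreases \<open>E\<close> by at least \<open>min (g k / 2) (\<rho> * (g k)\<^sup>2 / (2 * n * L))\<close>
  (\<open>step_decrease\<close>). This is increasing in the positive number \<open>g k\<close>, so \<open>T\<close> times its value at the smallest gap is at
  most \<open>E (U 0) - Estar\<close>; solving for the smallest gap in either branch of the minimum gives the two
  terms of the maximum (\<open>min_gap_rate\<close>).

  The total is bounded because the oracle returns feasible points: with step sizes in \<open>(0, 1]\<close> the
  iterates are convex combinations of feasible points, and on the convex feasible set \<open>Estar\<close> is a
  lower bound (\<open>gfw_sequence_feasible\<close>).\<close>

text \<open>Along the segment from \<open>x\<close> to \<open>x + d\<close>, subtracting from \<open>f\<close> its quadratic upper model leaves a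
  function of one variable whose derivative is nonpositive by Cauchy--Schwarz and the Lipschitz
  bound.\<close>

lemma descent_lemma:
  fixes f :: "'a::real_inner \<Rightarrow> real"
  assumes grad: "\<And>x. GDERIV f x :> G x" and lip: "L-lipschitz_on UNIV G"
  shows "f (x + d) \<le> f x + G x \<bullet> d + L / 2 * (norm d)\<^sup>2"
proof -
  define \<phi> where "\<phi> t = f (x + t *\<^sub>R d) - t * (G x \<bullet> d) - L / 2 * t\<^sup>2 * (norm d)\<^sup>2" for t
  have "(\<phi> has_real_derivative
      G (x + t *\<^sub>R d) \<bullet> d - G x \<bullet> d - L * t * (norm d)\<^sup>2) (at t)" for t
  proof -
    have "((\<lambda>t. x + t *\<^sub>R d) has_derivative (\<lambda>s. s *\<^sub>R d)) (at t)"
      by (auto intro!: derivative_eq_intros)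
    from has_derivative_compose[OF this grad[unfolded gderiv_def]]
    have "((\<lambda>t. f (x + t *\<^sub>R d)) has_derivative (\<lambda>s. (s *\<^sub>R d) \<bullet> G (x + t *\<^sub>R d))) (at t)" .
    moreover have "(\<lambda>s. (s *\<^sub>R d) \<bullet> G (x + t *\<^sub>R d)) = (*) (G (x + t *\<^sub>R d) \<bullet> d)"
      by (auto simp: inner_commute)
    ultimately have "((\<lambda>t. f (x + t *\<^sub>R d)) has_real_derivative G (x + t *\<^sub>R d) \<bullet> d) (at t)"
      by (simp add: has_field_derivative_def)
    then show ?thesis
      unfolding \<phi>_def by (auto intro!: derivative_eq_intros)
  qed
  moreover have "G (x + t *\<^sub>R d) \<bullet> d - G x \<bullet> d - L * t * (norm d)\<^sup>2 \<le> 0" if "0 \<le> t" for t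
  proof -
    have "G (x + t *\<^sub>R d) \<bullet> d - G x \<bullet> d \<le> norm (G (x + t *\<^sub>R d) - G x) * norm d"
      using norm_cauchy_schwarz[of "G (x + t *\<^sub>R d) - G x" d] by (simp add: inner_diff_left)
    also have "\<dots> \<le> (L * norm (t *\<^sub>R d)) * norm d"
      using lipschitz_onD[OF lip, of "x + t *\<^sub>R d" x]
      by (intro mult_right_mono) (simp_all add: dist_norm)
    also have "\<dots> = L * t * (norm d)\<^sup>2"
      using that by (simp add: power2_eq_square)
    finally show ?thesis by simp
  qed
  ultimately have "\<phi> 1 \<le> \<phi> 0"
    by (intro DERIV_nonpos_imp_nonincreasing[of 0 1 \<phi>] exI conjI) (simp, assumption, blast)
  then show ?thesis
    by (simp add: \<phi>_def)
qed

text \<open>\<open>a\<close> is the step actually taken and \<open>min 1 (g / (L * (norm d)\<^sup>2))\<close> the minimizer over \<open>[0, 1]\<close> of the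
  quadratic upper model; when the minimizer is \<open>1\<close>, so is \<open>a\<close>. The value \<open>g / 2\<close> is
  what remains of the first-order decrease \<open>g\<close> of a full step when the curvature term
  \<open>L / 2 * (norm d)\<^sup>2\<close> eats at most half of it.\<close>

lemma step_decrease:
  fixes f :: "'a::real_inner \<Rightarrow> real"
  assumes grad: "\<And>x. GDERIV f x :> G x" and lip: "L-lipschitz_on UNIV G"
    and "L > 0" "\<rho> > 0" and g: "g = - (G x \<bullet> d)" "g > 0" and M: "(norm d)\<^sup>2 \<le> M"
    and a: "min 1 (g / (L * (norm d)\<^sup>2)) \<le> a" "a \<le> 1"
    and dec: "\<rho> * min 1 (g / (L * (norm d)\<^sup>2)) * g \<le> f x - f (x + a *\<^sub>R d)"
  shows "min (g / 2) (\<rho> / (M * L) * g\<^sup>2) \<le> f x - f (x + a *\<^sub>R d)"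
proof -
  have "d \<noteq> 0"
    using g by auto
  then have pos: "L * (norm d)\<^sup>2 > 0"
    using \<open>L > 0\<close> by simp
  show ?thesis
  proof (cases "g / (L * (norm d)\<^sup>2) \<ge> 1")
    case True
    then have "a = 1" and "L * (norm d)\<^sup>2 \<le> g"
      using a pos by (auto simp: field_simps)
    then have "g / 2 \<le> f x - f (x + a *\<^sub>R d)"
      using descent_lemma[OF grad lip, of x d] g by simp
    then show ?thesis by simp
  next
    case False
    have "\<rho> / (M * L) * g\<^sup>2 \<le> \<rho> / (L * (norm d)\<^sup>2) * g\<^sup>2"
      using pos M \<open>d \<noteq> 0\<close> \<open>L > 0\<close> \<open>\<rho> > 0\<close>
      by (simp add: mult.commute[of M] frac_le mult_right_mono)
    also have "\<dots> = \<rho> * min 1 (g / (L * (norm d)\<^sup>2)) * g"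
      using False by (simp add: power2_eq_square)
    finally show ?thesis
      using dec by simp
  qed
qed

text \<open>The guard \<open>g k > 0\<close> costs nothing: if some gap is nonpositive, the claim is trivial because its
  right-hand side is nonnegative.\<close>

lemma min_gap_rate:
  fixes e g :: "nat \<Rightarrow> real"
  assumes dec: "\<And>k. g k > 0 \<Longrightarrow> min (g k / 2) (c * (g k)\<^sup>2) \<le> e k - e (Suc k)"
    and low: "\<And>k. m \<le> e k" and "c > 0" "T \<ge> 1"
  shows "(MIN i\<in>{0..T - 1}. g i) \<le> max (sqrt ((e 0 - m) / (c * T))) (2 * (e 0 - m) / T)"
proof -
  define h where "h = (MIN i\<in>{0..T - 1}. g i)"
  have T: "real T > 0"
    using \<open>T \<ge> 1\<close> by simp
  show ?thesis
  proof (cases "h \<le> 0")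
    case True
    moreover have "0 \<le> 2 * (e 0 - m) / T"
      using low[of 0] by simp
    ultimately show ?thesis
      unfolding h_def by linarith
  next
    case False
    have "min (h / 2) (c * h\<^sup>2) \<le> e k - e (Suc k)" if "k < T" for k
    proof -
      have "h \<le> g k"
        unfolding h_def using that by (intro Min_le) auto
      moreover have "h\<^sup>2 \<le> (g k)\<^sup>2"
        using False \<open>h \<le> g k\<close> by (intro power_mono) auto
      then have "c * h\<^sup>2 \<le> c * (g k)\<^sup>2"
        using \<open>c > 0\<close> by simp
      ultimately show ?thesis
        using dec[of k] False by linarith
    qed
    then have "(\<Sum>k<T. min (h / 2) (c * h\<^sup>2)) \<le> (\<Sum>k<T. e k - e (Suc k))"
      by (intro sum_mono) simp
    also have "\<dots> = e 0 - e T"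
      by (rule sum_lessThan_telescope')
    finally have total: "T * min (h / 2) (c * h\<^sup>2) \<le> e 0 - m"
      using low[of T] by simp
    show ?thesis
    proof (cases "h / 2 \<le> c * h\<^sup>2")
      case True
      then have "h \<le> 2 * (e 0 - m) / T"
        using total T by (simp add: min_def field_simps)
      then show ?thesis
        unfolding h_def by simp
    next
      case False
      then have "h\<^sup>2 \<le> (e 0 - m) / (c * T)"
        using total T \<open>c > 0\<close> by (simp add: min_def field_simps)
      then have "h \<le> sqrt ((e 0 - m) / (c * T))"
        by (rule real_le_rsqrt)
      then show ?thesis
        unfolding h_def by simp
    qed
  qed
qed

lemma glmo_output_feasible:
  assumes "U \<in> feasible" "glmo_output G U S"
  shows "S \<in> feasible"
proof -
  have "(\<forall>j. 0 \<le> S $ i $ j) \<and> (\<Sum>j\<in>UNIV. S $ i $ j) = 1" for i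
  proof (cases "\<forall>j. U $ i $ j \<in> {0, 1}")
    case True
    then have "S $ i = U $ i"
      using assms(2) unfolding glmo_output_def by presburger
    then show ?thesis
      using assms(1) by (simp add: feasible_def)
  next
    case False
    then obtain j where "S $ i = axis j 1"
      using assms(2) unfolding glmo_output_def by metis
    then show ?thesis
      by (simp add: axis_def)
  qed
  then show ?thesis
    by (simp add: feasible_def)
qed

lemma convex_feasible: "convex (feasible :: (real ^ 'k ^ 'n) set)"
  by (auto simp: convex_def feasible_def sum.distrib sum_distrib_left[symmetric])

lemma gfw_sequence_feasible:
  assumes "gfw_sequence grad U D \<alpha>"
  shows "U k \<in> feasible"
proof (induction k)
  case 0
  then show ?case
    using assms by (simp add: gfw_sequence_def)
next
  case (Suc k)
  obtain S where "glmo_output (grad (U k)) (U k) S" and D: "D k = S - U k"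
    using assms by (auto simp: gfw_sequence_def)
  then have "S \<in> feasible"
    using Suc glmo_output_feasible by blast
  moreover have "U (Suc k) = (1 - \<alpha> k) *\<^sub>R U k + \<alpha> k *\<^sub>R S" and "0 < \<alpha> k" "\<alpha> k \<le> 1"
    using assms D by (auto simp: gfw_sequence_def algebra_simps)
  ultimately show ?case
    using Suc convexD[OF convex_feasible, of "U k" S "1 - \<alpha> k" "\<alpha> k"] by simp
qed

text \<open>Rows of feasible matrices have norm at most \<open>1\<close>, and the cross term in the expansion of the
  squared distance has the favourable sign because the entries are nonnegative. (The triangle
  inequality would only give \<open>4 * n\<close>.)\<close>

lemma norm_diff_feasible:
  fixes S U :: "real ^ 'k ^ 'n"
  assumes S: "S \<in> feasible" and U: "U \<in> feasible"
  shows "(norm (S - U))\<^sup>2 \<le> 2 * real CARD('n)"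
proof -
  have row: "V $ i \<bullet> V $ i \<le> 1" if "V \<in> feasible" for V :: "real ^ 'k ^ 'n" and i
  proof -
    have "norm (V $ i) \<le> (\<Sum>j\<in>UNIV. \<bar>V $ i $ j\<bar>)"
      by (rule norm_le_l1_cart)
    also have "\<dots> = 1"
      using that by (simp add: feasible_def)
    finally show ?thesis
      by (simp add: dot_square_norm power_le_one)
  qed
  have "(norm (S - U))\<^sup>2 = (\<Sum>i\<in>UNIV. (S $ i - U $ i) \<bullet> (S $ i - U $ i))"
    by (simp add: power2_norm_eq_inner inner_vec_def[of "S - U"])
  also have "\<dots> \<le> (\<Sum>i\<in>(UNIV :: 'n set). 2)"
  proof (rule sum_mono)
    fix i
    have "0 \<le> S $ i \<bullet> U $ i"
      using S U by (auto simp: inner_vec_def feasible_def intro!: sum_nonneg)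
    then show "(S $ i - U $ i) \<bullet> (S $ i - U $ i) \<le> 2"
      using row[OF S, of i] row[OF U, of i]
      by (simp add: inner_diff_left inner_diff_right inner_commute)
  qed
  finally show ?thesis by simp
qed

theorem theorem4p1:
  fixes W :: "real ^ 'n ^ 'n" and F :: "'n set" and Uhat :: "real ^ 'k ^ 'n"
    and \<omega>0 \<epsilon> L \<rho> :: real
    and U D :: "nat \<Rightarrow> real ^ 'k ^ 'n" and \<alpha> \<alpha>bar g :: "nat \<Rightarrow> real"
    and \<omega> :: "real ^ 'n" and E :: "real ^ 'k ^ 'n \<Rightarrow> real"
    and gradE :: "real ^ 'k ^ 'n \<Rightarrow> real ^ 'k ^ 'n" and Estar \<rho>max dmax :: real and T :: nat
  assumes "transpose W = W"
    and "\<And>i j. 0 \<le> W $ i $ j"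
    and "connected_weights W"
    and "invertible (diag_mat (degrees W))"
    and "CARD('k) > 2"
    and "F \<noteq> {}"
    and "\<omega>0 > 0"
    and "\<And>i. i \<in> F \<Longrightarrow> \<exists>j. Uhat $ i = axis j 1"
  defines "\<omega> \<equiv> fidelity_weights F \<omega>0"
  defines "E \<equiv> energy W \<omega> Uhat \<epsilon>"
  defines "gradE \<equiv> grad_energy W \<omega> Uhat \<epsilon>"
  defines "Estar \<equiv> min_energy W \<omega> Uhat \<epsilon>"
  defines "\<rho>max \<equiv> (MAX i. \<Sum>j\<in>UNIV. \<bar>sym_laplacian W $ i $ j\<bar>)"
  defines "dmax \<equiv> (MAX i. diag_mat \<omega> $ i $ i)"
  assumes "0 < \<epsilon>" and "\<epsilon> < 1 / (real CARD('k) * (\<rho>max + dmax))"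
    and "L > 0"
    and "L-lipschitz_on UNIV gradE"
    and "gfw_sequence gradE U D \<alpha>"
  defines "g \<equiv> (\<lambda>k. - (gradE (U k) \<bullet> D k))"
  \<comment> \<open>if \<open>D k = 0\<close> the quotient is \<open>0 / 0 = 0\<close>\<close>
  defines "\<alpha>bar \<equiv> (\<lambda>k. min 1 (g k / (L * (norm (D k))\<^sup>2)))"
  assumes "\<And>k. \<alpha> k \<ge> \<alpha>bar k"
    and "\<rho> > 0"
    and "\<And>k. E (U k) - E (U k + \<alpha> k *\<^sub>R D k) \<ge> \<rho> * \<alpha>bar k * g k"
    and "T \<ge> 1"
  shows "(MIN i\<in>{0..T - 1}. g i)
           \<le> max (sqrt (2 * real CARD('n) * L * (E (U 0) - Estar) / (\<rho> * real T)))
                 (2 * (E (U 0) - Estar) / real T)"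
proof -
  have seq: "gfw_sequence gradE U D \<alpha>" by fact
  have \<alpha>: "\<alpha> k \<le> 1" and step: "U (Suc k) = U k + \<alpha> k *\<^sub>R D k" for k
    using seq by (auto simp: gfw_sequence_def)
  have "0 \<le> \<omega> $ i" for i
    using \<open>\<omega>0 > 0\<close> by (simp add: \<omega>_def fidelity_weights_def)
  then have grad: "GDERIV E X :> gradE X" for X
    unfolding E_def gradE_def by (intro grad_energy_correct \<open>transpose W = W\<close>)
  have low: "Estar \<le> E (U k)" for k
    using min_energy_attained[of W \<omega> Uhat \<epsilon>] gfw_sequence_feasible[OF seq, of k]
    unfolding E_def Estar_def by metis
  have D: "(norm (D k))\<^sup>2 \<le> 2 * real CARD('n)" for k
    using seq gfw_sequence_feasible[OF seq, of k] glmo_output_feasible norm_diff_feasible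
    unfolding gfw_sequence_def by metis
  have dec: "min (g k / 2) (\<rho> / (2 * real CARD('n) * L) * (g k)\<^sup>2) \<le> E (U k) - E (U (Suc k))"
    if "g k > 0" for k
    unfolding step
  proof (rule step_decrease[OF grad \<open>L-lipschitz_on UNIV gradE\<close> \<open>L > 0\<close> \<open>\<rho> > 0\<close> _ that D _ \<alpha>])
    show "g k = - (gradE (U k) \<bullet> D k)"
      by (simp add: g_def)
    show "min 1 (g k / (L * (norm (D k))\<^sup>2)) \<le> \<alpha> k"
      using \<open>\<And>k. \<alpha> k \<ge> \<alpha>bar k\<close>[of k] by (simp add: \<alpha>bar_def)
    show "\<rho> * min 1 (g k / (L * (norm (D k))\<^sup>2)) * g k \<le> E (U k) - E (U k + \<alpha> k *\<^sub>R D k)"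
      using \<open>\<And>k. E (U k) - E (U k + \<alpha> k *\<^sub>R D k) \<ge> \<rho> * \<alpha>bar k * g k\<close>[of k] by (simp add: \<alpha>bar_def)
  qed
  have "(MIN i\<in>{0..T - 1}. g i)
      \<le> max (sqrt ((E (U 0) - Estar) / (\<rho> / (2 * real CARD('n) * L) * T)))
             (2 * (E (U 0) - Estar) / T)"
    using \<open>L > 0\<close> \<open>\<rho> > 0\<close> \<open>T \<ge> 1\<close>
    by (intro min_gap_rate[where e = "\<lambda>k. E (U k)"] dec low) auto
  then show ?thesis
    by (simp add: mult.commute mult.left_commute)
qed

end
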